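(* Let $\alpha,\beta>-1$ and $0<k<\alpha+1$, and let $$W(x)=(1-x)^\alpha(1+x)^\beta\begin{pmatrix}4(\alpha+1)-2k(1-x)&2(\alpha+1-k)(1-x)\\2(\alpha+1-k)(1-x)&(\alpha+1-k)(1-x)^2\end{pmatrix},\qquad x\in(-1,1).$$ Then the weight matrix $W$ is a Darboux transformation of the direct sum $$w(x)=\begin{pmatrix}(1-x)^{\alpha+1}(1+x)^\beta&0\\0&(1-x)^{\alpha+1}(1+x)^{\beta+1}\end{pmatrix},\qquad x\in(-1,1).$$
   Context: Differential operators $D=\sum_{j}\partial^jF_j(x)$, $\partial=\frac{d}{dx}$, act on the right on matrix-valued functions: $P(x)\cdot D=\sum_j \partial^j(P)(x)F_j(x)$; the product satisfies $P\cdot(D_1D_2)=(P\cdot D_1)\cdot D_2$. $\operatorname{Mat}_N(\Omega[x])$ is the algebra of such operators with all $F_j\in\operatorname{Mat}_N(\mathbb C)[x]$. For a weight matrix $W$ of size $N$ on an interval (smooth, positive definite almost everywhere, with finite moments), the monic orthogonal polynomials $P_n$ are those with leading coefficient $I$, degree $n$, and $\int P_nWP_m^*\,dx=0$ for $n\neq m$; $\mathcal D(W)$ is the algebra of all $D\in\operatorname{Mat}_N(\Omega[x])$ such that for every $n\ge0$ there is $\Lambda_n(D)\in\operatorname{Mat}_N(\mathbb C)$ with $P_n\cdot D=\Lambda_n(D)P_n$. An operator $\mathcal V\in\operatorname{Mat}_N(\Omega[x])$ is degree-preserving if $\deg(P\cdot\mathcal V)=\deg P$ for all $P\in\operatorname{Mat}_N(\mathbb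 C)[x]$. Darboux transformation: for weight matrices $W,\widetilde W$ of size $N$ on the same interval with monic orthogonal polynomials $P_n,\widetilde P_n$, $\widetilde W$ is a Darboux transformation of $W$ if there is $D\in\mathcal D(W)$ that factors as $D=\mathcal V\mathcal N$ with $\mathcal V,\mathcal N\in\operatorname{Mat}_N(\Omega[x])$ degree-preserving and such that $P_n\cdot\mathcal V=A_n\widetilde P_n$ for all $n\in\mathbb N_0$, for some matrices $A_n\in\operatorname{Mat}_N(\mathbb C)$. *)

theory Defs
  imports "HOL-Analysis.Analysis" "HOL-Computational_Algebra.Polynomial"
begin

section \<open>Matrix polynomials\<close>

text \<open>
  \<open>Mat\<^sub>N(\<complex>)[x]\<close> is represented as the \<open>N \<times> N\<close> matrices with entries in \<open>\<complex>[x]\<close>, with \<open>**\<close> as product.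
\<close>

type_synonym 'n mat_poly = "complex poly ^ 'n ^ 'n"

definition mp_const :: "complex ^ 'n ^ 'n \<Rightarrow> 'n::finite mat_poly" where
  "mp_const A = (\<chi> i j. [:A $ i $ j:])"

definition mp_eval :: "'n::finite mat_poly \<Rightarrow> real \<Rightarrow> complex ^ 'n ^ 'n" where
  "mp_eval P x = (\<chi> i j. poly (P $ i $ j) (complex_of_real x))"

definition mp_coeff :: "'n::finite mat_poly \<Rightarrow> nat \<Rightarrow> complex ^ 'n ^ 'n" where
  "mp_coeff P m = (\<chi> i j. coeff (P $ i $ j) m)"

text \<open>As for \<^const>\<open>degree\<close>, the zero matrix polynomial gets degree 0.\<close>

definition mp_degree :: "'n::finite mat_poly \<Rightarrow> nat" where
  "mp_degree P = Max (range (\<lambda>(i, j). degree (P $ i $ j)))"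

definition mp_deriv :: "'n::finite mat_poly \<Rightarrow> 'n::finite mat_poly" where
  "mp_deriv P = (\<chi> i j. pderiv (P $ i $ j))"


section \<open>Differential operators with matrix polynomial coefficients\<close>

text \<open>
  The operator \<open>\<Sum>\<^sub>j \<partial>\<^sup>j F\<^sub>j(x)\<close> is represented by the polynomial in \<open>\<partial>\<close> whose \<open>j\<close>-th coefficient is
  \<open>F\<^sub>j\<close>; only the additive structure of this polynomial type is used.  In particular \<open>*\<close> on it is
  \<^emph>\<open>not\<close> the product of operators (it treats \<open>\<partial>\<close> as central and multiplies matrices entrywise).
\<close>

type_synonym 'n diff_op = "'n mat_poly poly"

definition op_act :: "'n::finite mat_poly \<Rightarrow> 'n::finite diff_op \<Rightarrow> 'n::finite mat_poly" (infixl "\<bullet>\<^sub>D" 70) where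
  "P \<bullet>\<^sub>D D = (\<Sum>j\<le>degree D. (mp_deriv ^^ j) P ** coeff D j)"

text \<open>
  The product of operators for the right action: by the Leibniz rule,
  \<open>(\<partial>\<^sup>i F)(\<partial>\<^sup>j G) = \<Sum>\<^sub>l\<^sub>\<le>\<^sub>j (j choose l) \<partial>\<^sup>i\<^sup>+\<^sup>l F\<^sup>(\<^sup>j\<^sup>-\<^sup>l\<^sup>) G\<close>; lemma \<open>op_act_op_mult\<close> below shows
  that it is compatible with the action.
\<close>

definition op_mult :: "'n::finite diff_op \<Rightarrow> 'n::finite diff_op \<Rightarrow> 'n::finite diff_op" (infixl "**\<^sub>D" 70) where
  "D **\<^sub>D E = (\<Sum>i\<le>degree D. \<Sum>j\<le>degree E. \<Sum>l\<le>j.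
     monom (mat (of_nat (j choose l)) ** ((mp_deriv ^^ (j - l)) (coeff D i) ** coeff E j)) (i + l))"

text \<open>
  With the usual convention \<open>deg 0 = -\<infinity>\<close>, preserving the degree includes not sending a nonzero
  matrix polynomial to zero.
\<close>

definition degree_preserving :: "'n::finite diff_op \<Rightarrow> bool" where
  "degree_preserving V \<longleftrightarrow> (\<forall>P. P \<noteq> 0 \<longrightarrow> P \<bullet>\<^sub>D V \<noteq> 0 \<and> mp_degree (P \<bullet>\<^sub>D V) = mp_degree P)"

subsection \<open>Compatibility of the product with the action\<close>

lemma higher_pderiv_times:
  "(pderiv ^^ n) (p * q :: complex poly) =
     (\<Sum>l\<le>n. of_nat (n choose l) * ((pderiv ^^ l) p * (pderiv ^^ (n - l)) q))"
proof (induction n)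
  case 0
  then show ?case by simp
next
  case (Suc n)
  define a where "a l m = (pderiv ^^ l) p * (pderiv ^^ m) q" for l m
  have da: "pderiv (of_nat c * a l m) = of_nat c * a (Suc l) m + of_nat c * a l (Suc m)" for c l m
    by (simp add: a_def pderiv_mult algebra_simps)
  have "(pderiv ^^ Suc n) (p * q) = pderiv (\<Sum>l\<le>n. of_nat (n choose l) * a l (n - l))"
    by (simp add: Suc a_def)
  also have "\<dots> = (\<Sum>l\<le>n. of_nat (n choose l) * a (Suc l) (n - l))
                 + (\<Sum>l\<le>n. of_nat (n choose l) * a l (Suc n - l))"
    by (simp add: higher_pderiv_sum[where n = 1, simplified] da sum.distrib Suc_diff_le)
  also have "(\<Sum>l\<le>n. of_nat (n choose l) * a l (Suc n - l))
           = (\<Sum>l\<le>Suc n. of_nat (n choose l) * a l (Suc n - l))"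
    by simp
  also have "\<dots> = a 0 (Suc n) + (\<Sum>l\<le>n. of_nat (n choose Suc l) * a (Suc l) (n - l))"
    by (subst sum.atMost_Suc_shift) simp
  also have "(\<Sum>l\<le>n. of_nat (n choose l) * a (Suc l) (n - l)) + \<dots>
     = a 0 (Suc n) + (\<Sum>l\<le>n. of_nat (Suc n choose Suc l) * a (Suc l) (n - l))"
    by (simp add: sum.distrib algebra_simps)
  also have "\<dots> = (\<Sum>l\<le>Suc n. of_nat (Suc n choose l) * a l (Suc n - l))"
    by (subst sum.atMost_Suc_shift) (simp del: binomial_Suc_Suc)
  finally show ?case by (simp add: a_def)
qed

lemma higher_mp_deriv_nth: "(mp_deriv ^^ k) P $ i $ j = (pderiv ^^ k) (P $ i $ j)"
  by (induction k) (auto simp: mp_deriv_def)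

lemma higher_mp_deriv_sum: "(mp_deriv ^^ k) (sum f A) = (\<Sum>a\<in>A. (mp_deriv ^^ k) (f a))"
  by (simp add: vec_eq_iff higher_mp_deriv_nth higher_pderiv_sum sum_component)

lemma mat_of_nat_mult_nth:
  fixes X :: "'n::finite mat_poly"
  shows "(mat (of_nat c) ** X) $ i $ j = of_nat c * X $ i $ j"
  by (simp add: matrix_matrix_mult_def mat_def if_distrib[where f = "\<lambda>y. y * _"] cong: if_cong)

lemma higher_mp_deriv_mult:
  fixes A B :: "'n::finite mat_poly"
  shows "(mp_deriv ^^ n) (A ** B) =
    (\<Sum>l\<le>n. mat (of_nat (n choose l)) ** ((mp_deriv ^^ l) A ** (mp_deriv ^^ (n - l)) B))"
  unfolding vec_eq_iff
proof (intro allI)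
  fix i j
  have "(mp_deriv ^^ n) (A ** B) $ i $ j
    = (\<Sum>k\<in>UNIV. \<Sum>l\<le>n. of_nat (n choose l) * ((pderiv ^^ l) (A $ i $ k) * (pderiv ^^ (n - l)) (B $ k $ j)))"
    by (simp add: higher_mp_deriv_nth matrix_matrix_mult_def higher_pderiv_sum higher_pderiv_times)
  also have "\<dots> = (\<Sum>l\<le>n. \<Sum>k\<in>UNIV. of_nat (n choose l) * ((pderiv ^^ l) (A $ i $ k) * (pderiv ^^ (n - l)) (B $ k $ j)))"
    by (rule sum.swap)
  also have "\<dots> = (\<Sum>l\<le>n. mat (of_nat (n choose l)) ** ((mp_deriv ^^ l) A ** (mp_deriv ^^ (n - l)) B)) $ i $ j"
    by (simp add: sum_component mat_of_nat_mult_nth)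
       (simp add: matrix_matrix_mult_def higher_mp_deriv_nth sum_distrib_left)
  finally show "(mp_deriv ^^ n) (A ** B) $ i $ j = \<dots>" .
qed

lemma mp_mult_sum_left:
  fixes B :: "'n::finite mat_poly"
  shows "sum f S ** B = (\<Sum>s\<in>S. f s ** B)"
  by (induction S rule: infinite_finite_induct) (auto simp: vec_eq_iff matrix_matrix_mult_def sum.distrib algebra_simps)

lemma mp_scalar_commute:
  fixes A B :: "'n::finite mat_poly"
  shows "mat (of_nat c) ** (A ** B) = A ** (mat (of_nat c) ** B)"
proof -
  have "mat (of_nat c) ** A = A ** mat (of_nat c)"
    by (simp add: vec_eq_iff matrix_matrix_mult_def mat_def if_distrib[where f = "\<lambda>y. y * _"]
        if_distrib[where f = "\<lambda>y. _ * y"] cong: if_cong)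
  then show ?thesis by (simp add: matrix_mul_assoc)
qed

lemma op_act_altdef:
  assumes "degree D \<le> n"
  shows "P \<bullet>\<^sub>D D = (\<Sum>j\<le>n. (mp_deriv ^^ j) P ** coeff D j)"
  unfolding op_act_def
  by (rule sum.mono_neutral_left) (use assms in \<open>auto simp: coeff_eq_0 not_le\<close>)

lemma op_act_0: "P \<bullet>\<^sub>D 0 = 0"
  by (simp add: op_act_def)

lemma op_act_add: "P \<bullet>\<^sub>D (D + E) = P \<bullet>\<^sub>D D + P \<bullet>\<^sub>D E"
proof -
  define n where "n = max (degree D) (degree E)"
  have "degree D \<le> n" "degree E \<le> n" "degree (D + E) \<le> n"
    by (auto simp: n_def intro: degree_add_le)
  then show ?thesis
    by (simp add: op_act_altdef[of _ n] matrix_add_ldistrib sum.distrib)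
qed

lemma op_act_sum: "P \<bullet>\<^sub>D sum f S = (\<Sum>s\<in>S. P \<bullet>\<^sub>D f s)"
  by (induction S rule: infinite_finite_induct) (auto simp: op_act_0 op_act_add)

lemma op_act_monom: "P \<bullet>\<^sub>D monom M j = (mp_deriv ^^ j) P ** M"
proof -
  have "P \<bullet>\<^sub>D monom M j = (\<Sum>i\<le>j. (mp_deriv ^^ i) P ** coeff (monom M j) i)"
    by (rule op_act_altdef) (rule degree_monom_le)
  also have "\<dots> = (\<Sum>i\<le>j. if i = j then (mp_deriv ^^ j) P ** M else 0)"
    by (rule sum.cong) auto
  finally show ?thesis by simp
qed

lemma op_act_op_mult: "P \<bullet>\<^sub>D (D **\<^sub>D E) = (P \<bullet>\<^sub>D D) \<bullet>\<^sub>D E"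
proof -
  have "(P \<bullet>\<^sub>D D) \<bullet>\<^sub>D E = (\<Sum>j\<le>degree E. \<Sum>i\<le>degree D.
      (mp_deriv ^^ j) ((mp_deriv ^^ i) P ** coeff D i) ** coeff E j)"
    by (simp add: op_act_def[of _ E] op_act_def[of P D] higher_mp_deriv_sum mp_mult_sum_left)
  also have "\<dots> = (\<Sum>i\<le>degree D. \<Sum>j\<le>degree E.
      (mp_deriv ^^ j) ((mp_deriv ^^ i) P ** coeff D i) ** coeff E j)"
    by (rule sum.swap)
  also have "\<dots> = (\<Sum>i\<le>degree D. \<Sum>j\<le>degree E. \<Sum>l\<le>j. (mp_deriv ^^ (i + l)) P **
      (mat (of_nat (j choose l)) ** ((mp_deriv ^^ (j - l)) (coeff D i) ** coeff E j)))"
  proof (intro sum.cong refl)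
    fix i j
    have "(mp_deriv ^^ l) ((mp_deriv ^^ i) P) = (mp_deriv ^^ (i + l)) P" for l
      by (simp add: funpow_add add.commute[of i l])
    then show "(mp_deriv ^^ j) ((mp_deriv ^^ i) P ** coeff D i) ** coeff E j =
      (\<Sum>l\<le>j. (mp_deriv ^^ (i + l)) P **
        (mat (of_nat (j choose l)) ** ((mp_deriv ^^ (j - l)) (coeff D i) ** coeff E j)))"
      by (simp add: higher_mp_deriv_mult mp_mult_sum_left mp_scalar_commute flip: matrix_mul_assoc)
  qed
  also have "\<dots> = P \<bullet>\<^sub>D (D **\<^sub>D E)"
    by (simp add: op_mult_def op_act_sum op_act_monom)
  finally show ?thesis ..
qed


section \<open>Weight matrices and their monic orthogonal polynomials\<close>

definition conj_transpose :: "complex ^ 'n ^ 'm \<Rightarrow> complex ^ 'm ^ 'n" where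
  "conj_transpose A = (\<chi> i j. cnj (A $ j $ i))"

definition positive_definite :: "complex ^ 'n ^ 'n \<Rightarrow> bool" where
  "positive_definite A \<longleftrightarrow> conj_transpose A = A \<and>
     (\<forall>v. v \<noteq> 0 \<longrightarrow> Re (\<Sum>i\<in>UNIV. \<Sum>j\<in>UNIV. cnj (v $ i) * A $ i $ j * v $ j) > 0)"

text \<open>\<open>g k\<close> is the \<open>k\<close>-th derivative of \<open>f\<close> on the open set \<open>I\<close>.\<close>

definition smooth_on :: "real set \<Rightarrow> (real \<Rightarrow> 'a::real_normed_vector) \<Rightarrow> bool" where
  "smooth_on I f \<longleftrightarrow> (\<exists>g. g 0 = f \<and>
     (\<forall>k. \<forall>x\<in>I. (g k has_vector_derivative g (Suc k) x) (at x)))"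

text \<open>Only the values of \<open>W\<close> on the open interval \<open>I\<close> are relevant.\<close>

definition weight_matrix :: "real set \<Rightarrow> (real \<Rightarrow> complex ^ 'n ^ 'n) \<Rightarrow> bool" where
  "weight_matrix I W \<longleftrightarrow> is_interval I \<and> open I \<and> I \<noteq> {} \<and> smooth_on I W \<and>
     (AE x in lborel. x \<in> I \<longrightarrow> positive_definite (W x)) \<and>
     (\<forall>m::nat. set_integrable lborel I (\<lambda>x. x ^ m *\<^sub>R W x))"

text \<open>
  For a weight matrix there is exactly one such sequence, so the existential quantifiers over it in
  the definitions below do not depend on a choice.  The integrands are integrable because all
  moments of \<open>W\<close> are finite.
\<close>

definition monic_orthogonal_polys ::
  "real set \<Rightarrow> (real \<Rightarrow> complex ^ 'n ^ 'n) \<Rightarrow> (nat \<Rightarrow> 'n::finite mat_poly) \<Rightarrow> bool" where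
  "monic_orthogonal_polys I W P \<longleftrightarrow>
     (\<forall>n. mp_degree (P n) = n \<and> mp_coeff (P n) n = mat 1) \<and>
     (\<forall>n m. n \<noteq> m \<longrightarrow>
        set_lebesgue_integral lborel I
          (\<lambda>x. mp_eval (P n) x ** W x ** conj_transpose (mp_eval (P m) x)) = 0)"

text \<open>The algebra \<open>\<D>(W)\<close>.\<close>

definition diff_op_algebra ::
  "real set \<Rightarrow> (real \<Rightarrow> complex ^ 'n ^ 'n) \<Rightarrow> 'n::finite diff_op set" where
  "diff_op_algebra I W = {D. \<exists>P. monic_orthogonal_polys I W P \<and>
     (\<forall>n. \<exists>\<Lambda>. P n \<bullet>\<^sub>D D = mp_const \<Lambda> ** P n)}"


section \<open>Darboux transformations\<close>

text \<open>\<open>W'\<close> is a Darboux transformation of \<open>W\<close>.\<close>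

definition darboux_transformation ::
  "real set \<Rightarrow> (real \<Rightarrow> complex ^ 'n ^ 'n) \<Rightarrow> (real \<Rightarrow> complex ^ 'n ^ 'n) \<Rightarrow> bool" where
  "darboux_transformation I W W' \<longleftrightarrow> weight_matrix I W \<and> weight_matrix I W' \<and>
     (\<exists>P P' D V N. monic_orthogonal_polys I W P \<and> monic_orthogonal_polys I W' P' \<and>
        D \<in> diff_op_algebra I W \<and> D = V **\<^sub>D N \<and>
        degree_preserving V \<and> degree_preserving N \<and>
        (\<forall>n. \<exists>A. P n \<bullet>\<^sub>D V = mp_const A ** P' n))"

end

theory Submission
  imports Defs
begin

text \<open>
  Put \<open>a = \<alpha> + 1\<close>, \<open>b = \<beta>\<close>, \<open>u = 1 - x\<close> and \<open>c = a + b + 1 - k\<close>.  Both weights are the scalar Jacobi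
  weight \<open>\<rho> = u\<^sup>\<alpha> (1 + x)\<^sup>\<beta>\<close> times a polynomial matrix, and completing the square gives, for row
  vectors \<open>(f, g)\<close>,

    \<open>(f, g) W (f, g)\<^sup>* = \<rho> ((a - k) |2 f + u g|\<^sup>2 + 2 k (1 + x) |f|\<^sup>2)\<close>.

  So \<open>(f, g)\<close> is the same as the pair \<open>(h, f)\<close> with \<open>h = 2 f + u g\<close>, subject to \<open>h(1) = 2 f(1)\<close>, in a
  diagonal Jacobi weight.  The Jacobi shift operators \<open>p \<mapsto> u p' - a p\<close> and
  \<open>q \<mapsto> u (1 + x) q' + (b + 1) u q - a (1 + x) q\<close> map the two entries of \<open>w\<close> to those diagonal weights;
  adding zero-order terms so that the condition at \<open>1\<close> holds, and so that the adjoint has polynomial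
  coefficients, leads to

    \<open>(p, q) V = (u p' - k p - (a - k) q, -2 p' + (1 + x) q' + c q)\<close>,

    \<open>(f, g) N = (-2 k ((1 + x) f' + c f + (a - k) g), (a - k) (-2 f' - u g' + (k + 1) g))\<close>.

  The integrand of \<open>\<langle>P V, Q\<rangle>\<^sub>W - \<langle>P, Q N\<rangle>\<^sub>w\<close> is the derivative of a function that vanishes at \<open>\<plusminus>1\<close>, so \<open>N\<close>
  is the adjoint of \<open>V\<close> (\<open>factors_adjoint\<close>).  The product \<open>V N\<close> is diagonal, and its entries are affine in
  the Jacobi operators of the two entries of \<open>w\<close> (\<open>factors_eigen\<close>).

  The rest follows from these two facts.  The triangular action of a Jacobi operator on powers of \<open>x\<close>
  yields monic eigenpolynomials, hence diagonal monic \<open>P\<^sub>n\<close> with \<open>P\<^sub>n V N = \<Lambda>\<^sub>n P\<^sub>n\<close>.  Since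
  \<open>\<langle>P\<^sub>n V, P\<^sub>m V\<rangle>\<^sub>W = \<langle>P\<^sub>n, P\<^sub>m V N\<rangle>\<^sub>w\<close> and eigenvalues of different degree are distinct, the \<open>P\<^sub>n\<close> are
  orthogonal for \<open>w\<close> and the \<open>P\<^sub>n V\<close> are orthogonal for \<open>W\<close> (\<open>orthogonal_eigenpolynomials\<close>).  As \<open>V\<close> is
  triangular with invertible leading symbol, \<open>P\<^sub>n V\<close> becomes monic of degree \<open>n\<close> after division by its
  leading coefficient, which is the matrix \<open>A\<^sub>n\<close> of the definition.
\<close>


section \<open>The Jacobi weight and its Pearson identity\<close>

lemma has_vector_derivative_vecI:
  fixes f :: "real \<Rightarrow> 'a::real_normed_vector ^ 'n"
  assumes "\<And>i. ((\<lambda>x. f x $ i) has_vector_derivative f' $ i) (at x)"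
  shows "(f has_vector_derivative f') (at x)"
  unfolding has_vector_derivative_def has_derivative_within
proof
  show "((\<lambda>y. (1 / norm (y - x)) *\<^sub>R (f y - (f x + (y - x) *\<^sub>R f'))) \<longlongrightarrow> 0) (at x)"
    by (rule vec_tendstoI)
       (use assms in \<open>auto simp: has_vector_derivative_def has_derivative_within\<close>)
qed (rule bounded_linear_scaleR_left)

definition jacobi_weight :: "real \<Rightarrow> real \<Rightarrow> real \<Rightarrow> real" where
  "jacobi_weight \<alpha> \<beta> x = (1 - x) powr \<alpha> * (1 + x) powr \<beta>"

text \<open>
  The polynomial factor left over when \<open>\<rho> (1 - x\<^sup>2) r\<close> is differentiated, \<open>\<rho>\<close> being the Jacobi weight
  with parameters \<open>\<alpha>, \<beta>\<close>.  For \<open>r = p'\<close> it is the Jacobi operator applied to \<open>p\<close>.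
\<close>

definition pearson :: "real \<Rightarrow> real \<Rightarrow> complex poly \<Rightarrow> complex poly" where
  "pearson \<alpha> \<beta> r = [:1, 0, -1:] * pderiv r
     + [:of_real (\<beta> - \<alpha>), - of_real (\<alpha> + \<beta> + 2):] * r"

lemma jacobi_weight_pos: "x \<in> {-1<..<1} \<Longrightarrow> jacobi_weight \<alpha> \<beta> x > 0"
  by (simp add: jacobi_weight_def)

lemma jacobi_weight_Suc:
  assumes "x \<in> {-1<..<1}"
  shows "jacobi_weight (\<alpha> + 1) \<beta> x = (1 - x) * jacobi_weight \<alpha> \<beta> x"
    and "jacobi_weight \<alpha> (\<beta> + 1) x = (1 + x) * jacobi_weight \<alpha> \<beta> x"
  using assms by (simp_all add: jacobi_weight_def powr_add)

lemma continuous_on_jacobi_weight: "continuous_on {-1<..<1} (jacobi_weight \<alpha> \<beta>)"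
  unfolding jacobi_weight_def by (intro continuous_intros) auto

text \<open>
  On each half of the interval one of the two powers is bounded, so the weight is dominated by a
  multiple of \<open>(1 - x)\<^sup>\<alpha> + (1 + x)\<^sup>\<beta>\<close>, whose summands have explicit antiderivatives.
\<close>

lemma set_integrable_jacobi_weight:
  assumes "\<alpha> > -1" "\<beta> > -1"
  shows "set_integrable lborel {-1<..<1} (jacobi_weight \<alpha> \<beta>)"
proof -
  have right: "set_integrable lborel (einterval (ereal (-1)) (ereal 1)) (\<lambda>x. (1 + x) powr c)"
    if "c > -1" for c :: real
  proof (rule interval_integral_FTC_nonneg(1))
    let ?F = "\<lambda>x. (1 + x) powr (c + 1) / (c + 1)"
    have cont: "continuous_on {-1..1} ?F"
      using that by (intro continuous_intros continuous_on_powr') auto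
    show "((?F \<circ> real_of_ereal) \<longlongrightarrow> ?F (-1)) (at_right (ereal (-1)))"
      using continuous_on_Icc_at_rightD[OF cont] by (simp add: ereal_tendsto_simps1)
    show "((?F \<circ> real_of_ereal) \<longlongrightarrow> ?F 1) (at_left (ereal 1))"
      using continuous_on_Icc_at_leftD[OF cont] by (simp add: ereal_tendsto_simps1)
    show "(?F has_field_derivative (1 + x) powr c) (at x)"
      if "ereal (-1) < ereal x" "ereal x < ereal 1" for x
      using that \<open>c > -1\<close> by (auto intro!: derivative_eq_intros)
    show "isCont (\<lambda>x. (1 + x) powr c) x" if "ereal (-1) < ereal x" "ereal x < ereal 1" for x
      using that by (auto intro!: continuous_intros)
  qed auto
  have left: "set_integrable lborel (einterval (ereal (-1)) (ereal 1)) (\<lambda>x. (1 - x) powr c)"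
    if "c > -1" for c :: real
  proof (rule interval_integral_FTC_nonneg(1))
    let ?F = "\<lambda>x. - ((1 - x) powr (c + 1) / (c + 1))"
    have cont: "continuous_on {-1..1} ?F"
      using that by (intro continuous_intros continuous_on_powr') auto
    show "((?F \<circ> real_of_ereal) \<longlongrightarrow> ?F (-1)) (at_right (ereal (-1)))"
      using continuous_on_Icc_at_rightD[OF cont] by (simp add: ereal_tendsto_simps1)
    show "((?F \<circ> real_of_ereal) \<longlongrightarrow> ?F 1) (at_left (ereal 1))"
      using continuous_on_Icc_at_leftD[OF cont] by (simp add: ereal_tendsto_simps1)
    show "(?F has_field_derivative (1 - x) powr c) (at x)"
      if "ereal (-1) < ereal x" "ereal x < ereal 1" for x
      using that \<open>c > -1\<close> by (auto intro!: derivative_eq_intros)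
    show "isCont (\<lambda>x. (1 - x) powr c) x" if "ereal (-1) < ereal x" "ereal x < ereal 1" for x
      using that by (auto intro!: continuous_intros)
  qed auto
  \<comment> \<open>The maxima with 1 cover negative exponents, for which the power decreases in its base.\<close>
  define C where "C = max 1 (2 powr \<alpha>) + max 1 (2 powr \<beta>)"
  have le: "t powr c \<le> max 1 (2 powr c)" if "1 \<le> t" "t \<le> 2" for t c :: real
  proof (cases "c \<ge> 0")
    case True
    then have "t powr c \<le> 2 powr c" using that by (intro powr_mono2) auto
    then show ?thesis by simp
  next
    case False
    then have "t powr c \<le> t powr 0" using that by (intro powr_mono) auto
    then show ?thesis using that by simp
  qed
  have "set_integrable lborel {-1<..<1} (\<lambda>x. C * ((1 - x) powr \<alpha> + (1 + x) powr \<beta>))"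
    using left[OF assms(1)] right[OF assms(2)] by simp
  then show ?thesis
  proof (rule set_integrable_bound)
    show "set_borel_measurable lborel {-1<..<1} (jacobi_weight \<alpha> \<beta>)"
      using borel_measurable_continuous_on_indicator[OF _ continuous_on_jacobi_weight]
      by (simp add: set_borel_measurable_def)
    show "AE x in lborel. x \<in> {-1<..<1} \<longrightarrow>
        norm (jacobi_weight \<alpha> \<beta> x) \<le> norm (C * ((1 - x) powr \<alpha> + (1 + x) powr \<beta>))"
    proof (rule AE_I2, rule impI)
      fix x :: real assume x: "x \<in> {-1<..<1}"
      have C: "C \<ge> 0" "max 1 (2 powr \<alpha>) \<le> C" "max 1 (2 powr \<beta>) \<le> C" by (auto simp: C_def)
      have "(1 - x) powr \<alpha> * (1 + x) powr \<beta> \<le> C * ((1 - x) powr \<alpha> + (1 + x) powr \<beta>)"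
      proof (cases "x \<le> 0")
        case True
        then have "(1 - x) powr \<alpha> * (1 + x) powr \<beta> \<le> C * (1 + x) powr \<beta>"
          using le[of "1 - x" \<alpha>] x C by (intro mult_right_mono) auto
        also have "\<dots> \<le> C * ((1 - x) powr \<alpha> + (1 + x) powr \<beta>)"
          using C by (intro mult_left_mono) auto
        finally show ?thesis .
      next
        case False
        then have "(1 - x) powr \<alpha> * (1 + x) powr \<beta> \<le> (1 - x) powr \<alpha> * C"
          using le[of "1 + x" \<beta>] x C by (intro mult_left_mono) auto
        also have "\<dots> \<le> C * ((1 - x) powr \<alpha> + (1 + x) powr \<beta>)"
          using C by (simp add: algebra_simps)
        finally show ?thesis .
      qed
      then show "norm (jacobi_weight \<alpha> \<beta> x) \<le> norm (C * ((1 - x) powr \<alpha> + (1 + x) powr \<beta>))"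
        using C by (simp add: jacobi_weight_def)
    qed
  qed
qed

lemma set_integrable_jacobi_weight_scaleR:
  fixes f :: "real \<Rightarrow> 'a::euclidean_space"
  assumes "\<alpha> > -1" "\<beta> > -1" "continuous_on {-1..1} f"
  shows "set_integrable lborel {-1<..<1} (\<lambda>x. jacobi_weight \<alpha> \<beta> x *\<^sub>R f x)"
proof -
  have "bounded (f ` {-1..1})"
    using assms(3) by (intro compact_imp_bounded compact_continuous_image) auto
  then obtain B where B: "\<And>x. x \<in> {-1..1} \<Longrightarrow> norm (f x) \<le> B"
    unfolding bounded_iff by blast
  have "set_integrable lborel {-1<..<1} (\<lambda>x. B * jacobi_weight \<alpha> \<beta> x)"
    using set_integrable_jacobi_weight[OF assms(1,2)] by simp
  then show ?thesis
  proof (rule set_integrable_bound)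
    have "continuous_on {-1<..<1} (\<lambda>x. jacobi_weight \<alpha> \<beta> x *\<^sub>R f x)"
      by (intro continuous_intros continuous_on_jacobi_weight continuous_on_subset[OF assms(3)]) auto
    then show "set_borel_measurable lborel {-1<..<1} (\<lambda>x. jacobi_weight \<alpha> \<beta> x *\<^sub>R f x)"
      using borel_measurable_continuous_on_indicator[of "{-1<..<1::real}"]
      by (simp add: set_borel_measurable_def del: scaleR_scaleR)
    show "AE x in lborel. x \<in> {-1<..<1} \<longrightarrow>
        norm (jacobi_weight \<alpha> \<beta> x *\<^sub>R f x) \<le> norm (B * jacobi_weight \<alpha> \<beta> x)"
    proof (rule AE_I2, rule impI)
      fix x :: real assume x: "x \<in> {-1<..<1}"
      have "norm (f x) \<le> \<bar>B\<bar>" using B[of x] x by auto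
      then show "norm (jacobi_weight \<alpha> \<beta> x *\<^sub>R f x) \<le> norm (B * jacobi_weight \<alpha> \<beta> x)"
        by (simp add: abs_mult mult.commute[of "\<bar>jacobi_weight \<alpha> \<beta> x\<bar>"] mult_right_mono)
    qed
  qed
qed

lemma has_vector_derivative_jacobi_weight_poly:
  assumes "x \<in> {-1<..<1}"
  shows "((\<lambda>x. jacobi_weight (\<alpha> + 1) (\<beta> + 1) x *\<^sub>R poly r (of_real x)) has_vector_derivative
    jacobi_weight \<alpha> \<beta> x *\<^sub>R poly (pearson \<alpha> \<beta> r) (of_real x)) (at x)"
proof -
  let ?J = "jacobi_weight \<alpha> \<beta> x"
  have J: "(jacobi_weight (\<alpha> + 1) (\<beta> + 1) has_vector_derivative
      ?J * ((\<beta> + 1) * (1 - x) - (\<alpha> + 1) * (1 + x))) (at x)"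
  proof -
    have "((\<lambda>x. (1 - x) powr (\<alpha> + 1)) has_real_derivative - ((\<alpha> + 1) * (1 - x) powr \<alpha>)) (at x)"
      and "((\<lambda>x. (1 + x) powr (\<beta> + 1)) has_real_derivative (\<beta> + 1) * (1 + x) powr \<beta>) (at x)"
      using assms by (auto intro!: derivative_eq_intros)
    from DERIV_mult[OF this] show ?thesis
      unfolding jacobi_weight_def has_real_derivative_iff_has_vector_derivative
      by (rule has_vector_derivative_eq_rhs) (use assms in \<open>simp add: powr_add algebra_simps\<close>)
  qed
  have P: "((\<lambda>x. poly r (of_real x)) has_vector_derivative poly (pderiv r) (of_real x)) (at x)"
    by (rule has_vector_derivative_real_field) (rule poly_DERIV)
  have eq: "jacobi_weight (\<alpha> + 1) (\<beta> + 1) x = (1 - x) * (1 + x) * ?J"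
    using assms by (simp add: jacobi_weight_Suc)
  show ?thesis
    by (rule has_vector_derivative_eq_rhs[OF has_vector_derivative_scaleR[OF
          J[folded has_real_derivative_iff_has_vector_derivative] P]], unfold eq)
       (simp add: pearson_def scaleR_conv_of_real algebra_simps)
qed

definition jacobi_integral :: "real \<Rightarrow> real \<Rightarrow> complex poly \<Rightarrow> complex" where
  "jacobi_integral \<alpha> \<beta> p =
     (LBINT x:{-1<..<1}. jacobi_weight \<alpha> \<beta> x *\<^sub>R poly p (of_real x))"

lemma set_integrable_jacobi_weight_poly:
  assumes "\<alpha> > -1" "\<beta> > -1"
  shows "set_integrable lborel {-1<..<1} (\<lambda>x. jacobi_weight \<alpha> \<beta> x *\<^sub>R poly p (complex_of_real x))"
  by (intro set_integrable_jacobi_weight_scaleR assms continuous_intros)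

lemma jacobi_integral_add:
  assumes "\<alpha> > -1" "\<beta> > -1"
  shows "jacobi_integral \<alpha> \<beta> (p + q) = jacobi_integral \<alpha> \<beta> p + jacobi_integral \<alpha> \<beta> q"
  using set_integrable_jacobi_weight_poly[OF assms]
  by (simp add: jacobi_integral_def scaleR_add_right set_integral_add)

lemma jacobi_integral_smult: "jacobi_integral \<alpha> \<beta> (smult c p) = c * jacobi_integral \<alpha> \<beta> p"
  by (simp add: jacobi_integral_def flip: mult_scaleR_right)

lemma jacobi_integral_0 [simp]: "jacobi_integral \<alpha> \<beta> 0 = 0"
  by (simp add: jacobi_integral_def)

lemma jacobi_integral_sum:
  assumes "\<alpha> > -1" "\<beta> > -1"
  shows "jacobi_integral \<alpha> \<beta> (sum f A) = (\<Sum>a\<in>A. jacobi_integral \<alpha> \<beta> (f a))"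
  by (induction A rule: infinite_finite_induct) (simp_all add: jacobi_integral_add assms)

text \<open>
  The integrand is the derivative of \<open>(1 - x)\<^sup>\<alpha>\<^sup>+\<^sup>1 (1 + x)\<^sup>\<beta>\<^sup>+\<^sup>1 r\<close>, which vanishes at both endpoints because
  both exponents are positive.  Every integration by parts below is an instance.
\<close>

lemma jacobi_integral_pearson:
  assumes "\<alpha> > -1" "\<beta> > -1"
  shows "jacobi_integral \<alpha> \<beta> (pearson \<alpha> \<beta> r) = 0"
proof -
  let ?F = "\<lambda>x. jacobi_weight (\<alpha> + 1) (\<beta> + 1) x *\<^sub>R poly r (complex_of_real x)"
  let ?f = "\<lambda>x. jacobi_weight \<alpha> \<beta> x *\<^sub>R poly (pearson \<alpha> \<beta> r) (complex_of_real x)"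
  have cont: "continuous_on {-1..1} ?F"
    unfolding jacobi_weight_def using assms
    by (intro continuous_intros continuous_on_powr') auto
  have "(LBINT x=ereal (-1)..ereal 1. ?f x) = ?F 1 - ?F (-1)"
  proof (rule interval_integral_FTC_integrable)
    show "((?F \<circ> real_of_ereal) \<longlongrightarrow> ?F (-1)) (at_right (ereal (-1)))"
      using continuous_on_Icc_at_rightD[OF cont] by (simp add: ereal_tendsto_simps1)
    show "((?F \<circ> real_of_ereal) \<longlongrightarrow> ?F 1) (at_left (ereal 1))"
      using continuous_on_Icc_at_leftD[OF cont] by (simp add: ereal_tendsto_simps1)
    show "(?F has_vector_derivative ?f x) (at x)" if "ereal (-1) < ereal x" "ereal x < ereal 1" for x
      using that by (intro has_vector_derivative_jacobi_weight_poly) auto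
    have "continuous_on {-1<..<1} ?f"
      by (intro continuous_intros continuous_on_jacobi_weight)
    then show "isCont ?f x" if "ereal (-1) < ereal x" "ereal x < ereal 1" for x
      using that continuous_on_eq_continuous_at[of "{-1<..<1::real}" ?f] by auto
    show "set_integrable lborel (einterval (ereal (-1)) (ereal 1)) ?f"
      using set_integrable_jacobi_weight_poly[OF assms] by simp
  qed auto
  then show ?thesis
    by (simp add: interval_integral_Ioo jacobi_integral_def jacobi_weight_def)
qed


section \<open>Matrix weights with a scalar Jacobi factor\<close>

text \<open>
  Smoothness: by \<open>has_vector_derivative_jacobi_weight_poly\<close>, differentiation lowers both exponents by
  one and keeps the form scalar Jacobi factor times polynomial matrix, so all derivatives are explicit.
\<close>

lemma weight_matrix_jacobi:
  fixes W :: "real \<Rightarrow> complex ^ 'n ^ 'n::finite" and M :: "'n mat_poly"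
  assumes "\<alpha> > -1" "\<beta> > -1"
    and W: "\<And>x. x \<in> {-1<..<1} \<Longrightarrow> W x = jacobi_weight \<alpha> \<beta> x *\<^sub>R mp_eval M x"
    and pos: "\<And>x. x \<in> {-1<..<1} \<Longrightarrow> positive_definite (W x)"
  shows "weight_matrix {-1<..<1} W"
proof -
  have "smooth_on {-1<..<1} W"
  proof -
    define Ms where "Ms k = rec_nat M (\<lambda>k R. \<chi> i j.
      pearson (\<alpha> - real (Suc k)) (\<beta> - real (Suc k)) (R $ i $ j)) k" for k
    define g where "g k = (if k = 0 then W
      else (\<lambda>x. jacobi_weight (\<alpha> - real k) (\<beta> - real k) x *\<^sub>R mp_eval (Ms k) x))" for k
    have "g 0 = W \<and> (\<forall>k. \<forall>x\<in>{-1<..<1}. (g k has_vector_derivative g (Suc k) x) (at x))"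
    proof (intro conjI allI ballI)
      show "g 0 = W" by (simp add: g_def)
      fix k :: nat and x :: real assume x: "x \<in> {-1<..<1}"
      have g: "g k x = jacobi_weight (\<alpha> - real k) (\<beta> - real k) x *\<^sub>R mp_eval (Ms k) x"
        if "x \<in> {-1<..<1}" for k x
        using that by (cases k) (simp_all add: g_def W Ms_def)
      have "((\<lambda>x. jacobi_weight (\<alpha> - real k) (\<beta> - real k) x *\<^sub>R mp_eval (Ms k) x)
          has_vector_derivative g (Suc k) x) (at x)"
      proof (intro has_vector_derivative_vecI)
        fix i j
        show "((\<lambda>x. (jacobi_weight (\<alpha> - real k) (\<beta> - real k) x *\<^sub>R mp_eval (Ms k) x) $ i $ j)
          has_vector_derivative g (Suc k) x $ i $ j) (at x)"
          using has_vector_derivative_jacobi_weight_poly[OF x, of "\<alpha> - real (Suc k)"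
              "\<beta> - real (Suc k)" "Ms k $ i $ j"]
          by (simp add: g[OF x] mp_eval_def Ms_def)
      qed
      then show "(g k has_vector_derivative g (Suc k) x) (at x)"
        by (rule has_vector_derivative_transform_within_open[where S = "{-1<..<1}"])
          (use x g in auto)
    qed
    then show ?thesis unfolding smooth_on_def by blast
  qed
  moreover have "set_integrable lborel {-1<..<1} (\<lambda>x. x ^ m *\<^sub>R W x)" for m :: nat
  proof -
    have "set_integrable lborel {-1<..<1} (\<lambda>x. jacobi_weight \<alpha> \<beta> x *\<^sub>R (x ^ m *\<^sub>R mp_eval M x))"
      unfolding mp_eval_def
      by (intro set_integrable_jacobi_weight_scaleR assms continuous_intros)
    then show ?thesis
      by (rule set_integrable_cong[THEN iffD1, rotated -1]) (auto simp: W)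
  qed
  ultimately show ?thesis
    using pos by (auto simp: weight_matrix_def is_interval_oo)
qed

text \<open>
  Completing the square: \<open>x v\<^sup>*A v = |x v\<^sub>1 + y v\<^sub>2|\<^sup>2 + (x z - y\<^sup>2) |v\<^sub>2|\<^sup>2\<close>.
\<close>

lemma positive_definite_2:
  assumes "x > 0" "x * z - y\<^sup>2 > 0"
  shows "positive_definite (vector [vector [complex_of_real x, complex_of_real y],
    vector [complex_of_real y, complex_of_real z]] :: complex ^ 2 ^ 2)"
    (is "positive_definite ?A")
  unfolding positive_definite_def
proof (intro conjI allI impI)
  show "conj_transpose ?A = ?A"
    by (simp add: conj_transpose_def vec_eq_iff forall_2)
next
  fix v :: "complex ^ 2" assume "v \<noteq> 0"
  define q where "q = Re (\<Sum>i\<in>UNIV. \<Sum>j\<in>UNIV. cnj (v $ i) * ?A $ i $ j * v $ j)"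
  have "(cmod z)\<^sup>2 = Re z * Re z + Im z * Im z" for z
    by (subst cmod_power2) (simp add: power2_eq_square)
  then have "x * q = (cmod (x * v $ 1 + y * v $ 2))\<^sup>2 + (x * z - y\<^sup>2) * (cmod (v $ 2))\<^sup>2"
    by (simp add: q_def sum_2 algebra_simps) (simp add: power2_eq_square algebra_simps)
  also have "\<dots> > 0"
  proof (cases "v $ 2 = 0")
    case True
    then have "v $ 1 \<noteq> 0" using \<open>v \<noteq> 0\<close> by (auto simp: vec_eq_iff forall_2)
    with True assms show ?thesis by simp
  next
    case False
    with assms show ?thesis by (intro add_nonneg_pos) auto
  qed
  finally show "q > 0" using assms(1) by (simp add: zero_less_mult_iff)
qed

lemma mp_eval_mult: "mp_eval (P ** Q) x = mp_eval P x ** mp_eval Q x"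
  by (simp add: mp_eval_def matrix_matrix_mult_def vec_eq_iff poly_sum)

lemma mp_eval_mp_const: "mp_eval (mp_const C) x = C"
  by (simp add: mp_eval_def mp_const_def vec_eq_iff)

lemma conj_transpose_mult: "conj_transpose (A ** B) = conj_transpose B ** conj_transpose A"
  by (simp add: conj_transpose_def matrix_matrix_mult_def vec_eq_iff mult.commute)

lemma set_integral_jacobi_weight_mp_eval:
  fixes R :: "'n::finite mat_poly"
  assumes "\<alpha> > -1" "\<beta> > -1"
  shows "(LBINT x:{-1<..<1}. jacobi_weight \<alpha> \<beta> x *\<^sub>R mp_eval R x) $ i $ j =
    jacobi_integral \<alpha> \<beta> (R $ i $ j)"
proof -
  have "set_integrable lborel {-1<..<1} (\<lambda>x. jacobi_weight \<alpha> \<beta> x *\<^sub>R mp_eval R x)"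
    unfolding mp_eval_def by (intro set_integrable_jacobi_weight_scaleR assms continuous_intros)
  moreover have "bounded_linear (\<lambda>A :: complex ^ 'n ^ 'n. A $ i $ j)"
    by (rule bounded_linear_compose[OF bounded_linear_vec_nth bounded_linear_vec_nth])
  ultimately have "(LBINT x:{-1<..<1}. jacobi_weight \<alpha> \<beta> x *\<^sub>R mp_eval R x) $ i $ j =
      (LBINT x:{-1<..<1}. (jacobi_weight \<alpha> \<beta> x *\<^sub>R mp_eval R x) $ i $ j)"
    unfolding set_lebesgue_integral_def set_integrable_def
    by (subst integral_bounded_linear[symmetric]) auto
  then show ?thesis
    by (simp add: jacobi_integral_def mp_eval_def)
qed

text \<open>
  Reduces orthogonality with respect to a matrix weight to the vanishing of scalar Jacobi integrals of
  polynomials.  For \<open>Y\<close> with real values the conjugate transpose is the transpose, so the bilinear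
  form computed in \<open>\<complex>[x]\<close> suffices; the constants \<open>C\<close> and \<open>D\<close> are there for the normalization to monic
  polynomials.
\<close>

lemma set_integral_eq_0_if_jacobi_integral_eq_0:
  fixes X Y M :: "'n::finite mat_poly"
  assumes "\<alpha> > -1" "\<beta> > -1"
    and W: "\<And>x. x \<in> {-1<..<1} \<Longrightarrow> W x = jacobi_weight \<alpha> \<beta> x *\<^sub>R mp_eval M x"
    and real: "\<And>x i j. poly (Y $ i $ j) (complex_of_real x) \<in> \<real>"
    and 0: "\<And>i j. jacobi_integral \<alpha> \<beta> ((X ** M ** transpose Y) $ i $ j) = 0"
  shows "(LBINT x:{-1<..<1}. mp_eval (mp_const C ** X) x ** W x
           ** conj_transpose (mp_eval (mp_const D ** Y) x)) = 0"
proof -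
  define R where "R = mp_const C ** (X ** M ** transpose Y) ** mp_const (conj_transpose D)"
  have "conj_transpose (mp_eval Y x) = mp_eval (transpose Y) x" for x
    using real by (simp add: conj_transpose_def mp_eval_def transpose_def vec_eq_iff Reals_cnj_iff)
  then have "mp_eval (mp_const C ** X) x ** W x ** conj_transpose (mp_eval (mp_const D ** Y) x)
      = jacobi_weight \<alpha> \<beta> x *\<^sub>R mp_eval R x" if "x \<in> {-1<..<1}" for x
    by (simp add: W[OF that] R_def mp_eval_mult mp_eval_mp_const conj_transpose_mult
        matrix_mul_assoc matrix_scalar_ac scalar_matrix_assoc[symmetric])
  then have "(LBINT x:{-1<..<1}. mp_eval (mp_const C ** X) x ** W x
           ** conj_transpose (mp_eval (mp_const D ** Y) x))
      = (LBINT x:{-1<..<1}. jacobi_weight \<alpha> \<beta> x *\<^sub>R mp_eval R x)"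
    by (intro set_lebesgue_integral_cong) auto
  also have "\<dots> = 0"
  proof -
    have "jacobi_integral \<alpha> \<beta> (R $ i $ j) = 0" for i j
    proof -
      have "R $ i $ j = (\<Sum>l\<in>UNIV. smult (conj_transpose D $ l $ j)
          (\<Sum>m\<in>UNIV. smult (C $ i $ m) ((X ** M ** transpose Y) $ m $ l)))"
        unfolding R_def matrix_matrix_mult_def[of _ "mp_const _"]
          matrix_matrix_mult_def[of "mp_const _"]
        by (simp add: mp_const_def mult.commute)
      then show ?thesis
        by (simp add: jacobi_integral_sum jacobi_integral_smult assms(1,2) 0)
    qed
    then show ?thesis
      by (simp add: vec_eq_iff set_integral_jacobi_weight_mp_eval assms(1,2))
  qed
  finally show ?thesis .
qed


section \<open>First-order operators and degrees\<close>

text \<open>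
  The bridge from \<^const>\<open>mp_degree\<close> to matrix coefficients, in terms of which the action of an
  operator on leading terms is matrix multiplication.
\<close>

lemma mp_degree_le_iff: "mp_degree P \<le> n \<longleftrightarrow> (\<forall>m>n. mp_coeff P m = 0)"
proof -
  have "mp_degree P \<le> n \<longleftrightarrow> (\<forall>i j. degree (P $ i $ j) \<le> n)"
    by (auto simp: mp_degree_def)
  also have "\<dots> \<longleftrightarrow> (\<forall>i j. \<forall>m>n. coeff (P $ i $ j) m = 0)"
    by (auto intro: degree_le coeff_eq_0 le_less_trans)
  also have "\<dots> \<longleftrightarrow> (\<forall>m>n. mp_coeff P m = 0)"
    by (auto simp: mp_coeff_def vec_eq_iff)
  finally show ?thesis .
qed

lemma mp_coeff_mp_degree_neq_0:
  assumes "P \<noteq> 0"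
  shows "mp_coeff P (mp_degree P) \<noteq> 0"
proof
  assume 0: "mp_coeff P (mp_degree P) = 0"
  have all: "\<forall>m>mp_degree P. mp_coeff P m = 0"
    using mp_degree_le_iff by blast
  have "mp_coeff P m = 0" for m
  proof (cases "mp_degree P")
    case 0
    with all \<open>mp_coeff P (mp_degree P) = 0\<close> show ?thesis by (cases m) auto
  next
    case (Suc d)
    then have "mp_degree P \<le> d"
      using all 0 unfolding mp_degree_le_iff by (metis Suc_lessI)
    with Suc show ?thesis by simp
  qed
  then have "P = 0"
    by (simp add: mp_coeff_def vec_eq_iff poly_eq_iff)
  with assms show False by simp
qed

lemma mp_degree_eqI:
  assumes "\<And>m. m > n \<Longrightarrow> mp_coeff P m = 0" "mp_coeff P n \<noteq> 0"
  shows "mp_degree P = n"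
proof (rule antisym)
  show "mp_degree P \<le> n" using assms(1) by (simp add: mp_degree_le_iff)
  show "n \<le> mp_degree P"
    using assms(2) mp_degree_le_iff[of P "mp_degree P"] by (meson not_le order_refl)
qed

lemma mp_coeff_mp_const_mult: "mp_coeff (mp_const C ** P) m = C ** mp_coeff P m"
  by (simp add: mp_coeff_def mp_const_def matrix_matrix_mult_def coeff_sum vec_eq_iff)

lemma mp_const_mult: "mp_const (A ** B) = mp_const A ** mp_const B"
  by (simp add: mp_const_def matrix_matrix_mult_def vec_eq_iff poly_eq_iff coeff_sum coeff_pCons
      mult.commute split: nat.split)

lemma mp_const_mat_1_mult: "mp_const (mat 1) ** P = (P :: 'n::finite mat_poly)"
proof -
  have "mp_const (mat 1) = (mat 1 :: 'n mat_poly)"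
    by (simp add: mp_const_def mat_def vec_eq_iff)
  then show ?thesis by simp
qed

lemma op_act_first_order: "P \<bullet>\<^sub>D [:V0, V1:] = P ** V0 + mp_deriv P ** V1"
proof -
  have "P \<bullet>\<^sub>D [:V0, V1:] = (\<Sum>j\<le>1. (mp_deriv ^^ j) P ** coeff [:V0, V1:] j)"
    by (rule op_act_altdef) (simp add: degree_pCons_le)
  then show ?thesis by simp
qed

text \<open>
  For \<open>\<partial> V + A\<close> with \<open>deg V \<le> 1\<close>: the matrix by which the operator multiplies the leading coefficient
  of a polynomial of degree \<open>m\<close>.
\<close>

definition symbol_at :: "complex ^ 'n ^ 'n \<Rightarrow> 'n::finite mat_poly \<Rightarrow> nat \<Rightarrow> complex ^ 'n ^ 'n" where
  "symbol_at A V m = (\<chi> i j. A $ i $ j + of_nat m * coeff (V $ i $ j) 1)"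

lemma symbol_at_nth: "symbol_at A V m $ i $ j = A $ i $ j + of_nat m * coeff (V $ i $ j) 1"
  by (simp add: symbol_at_def)

lemma coeff_pderiv_mult_linear:
  fixes p v :: "complex poly"
  assumes "degree v \<le> 1"
  shows "coeff (pderiv p * v) m =
    of_nat m * coeff p m * coeff v 1 + of_nat (Suc m) * coeff p (Suc m) * coeff v 0"
proof -
  have "v = [:coeff v 0, coeff v 1:]"
    using assms by (auto simp: poly_eq_iff coeff_pCons coeff_eq_0 split: nat.split)
  then obtain c d where "v = [:c, d:]" by blast
  then show ?thesis
    by (cases m) (simp_all add: coeff_pderiv algebra_simps)
qed

lemma mp_coeff_op_act_first_order:
  assumes "\<And>i j. degree (V $ i $ j) \<le> 1"
  shows "mp_coeff (P \<bullet>\<^sub>D [:mp_const A, V:]) m =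
    mp_coeff P m ** symbol_at A V m + real (Suc m) *\<^sub>R (mp_coeff P (Suc m) ** mp_coeff V 0)"
  unfolding vec_eq_iff
proof (intro allI)
  fix i j
  have "mp_coeff (P \<bullet>\<^sub>D [:mp_const A, V:]) m $ i $ j = (\<Sum>l\<in>UNIV. coeff (P $ i $ l) m * A $ l $ j)
      + (\<Sum>l\<in>UNIV. coeff (pderiv (P $ i $ l) * V $ l $ j) m)"
    by (simp add: op_act_first_order mp_coeff_def matrix_matrix_mult_def mp_const_def mp_deriv_def
        coeff_sum mult.commute)
  also have "(\<Sum>l\<in>UNIV. coeff (pderiv (P $ i $ l) * V $ l $ j) m) =
      (\<Sum>l\<in>UNIV. coeff (P $ i $ l) m * (of_nat m * coeff (V $ l $ j) 1))
      + of_nat (Suc m) * (\<Sum>l\<in>UNIV. coeff (P $ i $ l) (Suc m) * coeff (V $ l $ j) 0)"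
    unfolding coeff_pderiv_mult_linear[OF assms]
    by (simp add: sum.distrib sum_distrib_left mult_ac del: of_nat_Suc)
  finally show "mp_coeff (P \<bullet>\<^sub>D [:mp_const A, V:]) m $ i $ j =
      (mp_coeff P m ** symbol_at A V m + real (Suc m) *\<^sub>R (mp_coeff P (Suc m) ** mp_coeff V 0)) $ i $ j"
    unfolding vector_add_component vector_scaleR_component
    by (simp add: symbol_at_nth mp_coeff_def matrix_matrix_mult_def sum.distrib distrib_left
        scaleR_conv_of_real del: of_nat_Suc)
qed

lemma mult_invertible_eq_0:
  fixes X A :: "complex ^ 'n ^ 'n::finite"
  assumes "invertible A" "X ** A = 0"
  shows "X = 0"
proof -
  from assms(1) obtain B where "A ** B = mat 1" unfolding invertible_def by blast
  moreover have "X ** (A ** B) = 0"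
    using assms(2) by (simp add: matrix_mul_assoc)
  ultimately show ?thesis by simp
qed

text \<open>
  The leading coefficient is multiplied by an invertible matrix, so it does not vanish.
\<close>

lemma degree_preserving_first_order:
  assumes deg: "\<And>i j. degree (V $ i $ j) \<le> 1"
    and inv: "\<And>m. invertible (symbol_at A V m)"
  shows "degree_preserving [:mp_const A, V:]"
  unfolding degree_preserving_def
proof (intro allI impI)
  fix P :: "'a mat_poly" assume "P \<noteq> 0"
  have van: "mp_coeff P m = 0" if "m > mp_degree P" for m
    using that mp_degree_le_iff by blast
  have n: "mp_coeff (P \<bullet>\<^sub>D [:mp_const A, V:]) (mp_degree P) \<noteq> 0"
    using mult_invertible_eq_0[OF inv] mp_coeff_mp_degree_neq_0[OF \<open>P \<noteq> 0\<close>]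
    by (auto simp: mp_coeff_op_act_first_order[OF deg] van)
  have "mp_degree (P \<bullet>\<^sub>D [:mp_const A, V:]) = mp_degree P"
    by (rule mp_degree_eqI[OF _ n]) (simp add: mp_coeff_op_act_first_order[OF deg] van)
  moreover have "P \<bullet>\<^sub>D [:mp_const A, V:] \<noteq> 0"
    using n by (intro notI) (simp add: mp_coeff_def vec_eq_iff)
  ultimately show "P \<bullet>\<^sub>D [:mp_const A, V:] \<noteq> 0 \<and>
      mp_degree (P \<bullet>\<^sub>D [:mp_const A, V:]) = mp_degree P"
    by simp
qed


section \<open>Monic Jacobi polynomials as eigenfunctions\<close>

definition jacobi_eigenvalue :: "real \<Rightarrow> real \<Rightarrow> nat \<Rightarrow> real" where
  "jacobi_eigenvalue a b n = real n * (real n + a + b + 1)"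

lemma jacobi_eigenvalue_inj:
  assumes "a + b > -2" "m \<noteq> n"
  shows "jacobi_eigenvalue a b m \<noteq> jacobi_eigenvalue a b n"
proof -
  have "real m + real n \<ge> 1" using assms(2) by linarith
  then have "(real m - real n) * (real m + real n + a + b + 1) \<noteq> 0"
    using assms by simp
  then show ?thesis by (auto simp: jacobi_eigenvalue_def algebra_simps)
qed

text \<open>
  The operator is upper triangular on the powers of \<open>x\<close>, with minus the eigenvalues on the diagonal.
\<close>

lemma coeff_jacobi_operator:
  "coeff (pearson a b (pderiv p)) i =
     of_nat ((i + 2) * (i + 1)) * coeff p (i + 2) + of_real (b - a) * of_nat (i + 1) * coeff p (i + 1)
     - of_real (jacobi_eigenvalue a b i) * coeff p i"
proof -
  consider "i = 0" | "i = 1" | l where "i = Suc (Suc l)"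
    by (metis One_nat_def not0_implies_Suc)
  then show ?thesis
    by cases (simp_all add: pearson_def jacobi_eigenvalue_def coeff_pderiv algebra_simps)
qed

lemma pearson_add: "pearson a b (p + q) = pearson a b p + pearson a b q"
  by (simp only: pearson_def pderiv_add algebra_simps)

text \<open>
  Since the diagonal entries are distinct, \<open>L + \<lambda>\<^sub>n\<close> is invertible on polynomials of degree less than \<open>n\<close>:
  back substitution eliminates the leading coefficient of the right-hand side.  Keeping the
  coefficients real matters because the weights pair a polynomial with a conjugate.
\<close>

lemma jacobi_operator_solve:
  assumes ab: "a + b > -2" and "m \<le> n"
    and "\<And>i. coeff r i \<in> \<real>" and "\<And>i. i \<ge> m \<Longrightarrow> coeff r i = 0"
  shows "\<exists>p. (\<forall>i. coeff p i \<in> \<real>) \<and> (\<forall>i\<ge>m. coeff p i = 0) \<and>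
    pearson a b (pderiv p) + smult (of_real (jacobi_eigenvalue a b n)) p = r"
  using assms(2-)
proof (induction m arbitrary: r)
  case 0
  then show ?case
    by (intro exI[of _ 0]) (auto simp: pearson_def poly_eq_iff)
next
  case (Suc m)
  let ?e = "jacobi_eigenvalue a b"
  define c where "c = coeff r m / of_real (?e n - ?e m)"
  have c: "c \<in> \<real>" using Suc.prems by (auto simp: c_def)
  define r' where "r' = r - (pearson a b (pderiv (monom c m)) + smult (of_real (?e n)) (monom c m))"
  have "?e n \<noteq> ?e m"
    using jacobi_eigenvalue_inj[OF ab] Suc.prems(1) by (metis Suc_le_lessD less_irrefl)
  then have cm: "c * (of_real (?e n) - of_real (?e m)) = coeff r m"
    by (simp add: c_def flip: of_real_diff)
  have co: "coeff r' i = coeff r i - (of_nat ((i + 2) * (i + 1)) * coeff (monom c m) (i + 2)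
      + of_real (b - a) * of_nat (i + 1) * coeff (monom c m) (i + 1)
      + of_real (?e n - ?e i) * coeff (monom c m) i)" for i
    unfolding r'_def coeff_diff coeff_add coeff_jacobi_operator by (simp add: algebra_simps)
  have "coeff r' i \<in> \<real>" for i
    unfolding co using Suc.prems(2) c
    by (intro Reals_diff Reals_add Reals_mult Reals_of_nat Reals_of_real) auto
  moreover have "coeff r' i = 0" if "i \<ge> m" for i
    using that Suc.prems(3)[of i] cm unfolding co by (cases "i = m") (auto simp: algebra_simps)
  ultimately obtain p where p: "\<forall>i. coeff p i \<in> \<real>" "\<forall>i\<ge>m. coeff p i = 0"
    "pearson a b (pderiv p) + smult (of_real (?e n)) p = r'"
    using Suc.IH[of r'] Suc.prems(1) by auto
  have "pearson a b (pderiv (monom c m + p)) + smult (of_real (?e n)) (monom c m + p) = r"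
    using p(3) by (simp add: r'_def pderiv_add pearson_add smult_add_right algebra_simps)
  moreover have "\<forall>i. coeff (monom c m + p) i \<in> \<real>" "\<forall>i\<ge>Suc m. coeff (monom c m + p) i = 0"
    using p c by auto
  ultimately show ?case by blast
qed

text \<open>
  \<open>(L + \<lambda>\<^sub>n) x\<^sup>n\<close> has degree less than \<open>n\<close>, so it can be cancelled by a correction of degree less than \<open>n\<close>.
\<close>

lemma monic_jacobi_polynomial_exists:
  assumes "a + b > -2"
  obtains p where "\<And>i. coeff p i \<in> \<real>" "coeff p n = 1" "\<And>i. i > n \<Longrightarrow> coeff p i = 0"
    "pearson a b (pderiv p) = smult (- of_real (jacobi_eigenvalue a b n)) p"
proof -
  let ?e = "of_real (jacobi_eigenvalue a b n)"
  let ?r = "- (pearson a b (pderiv (monom 1 n)) + smult ?e (monom 1 n))"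
  have "coeff ?r i \<in> \<real>" for i
    unfolding coeff_minus coeff_add coeff_jacobi_operator
    by (intro Reals_diff Reals_add Reals_mult Reals_of_nat Reals_of_real Reals_minus) auto
  moreover have "coeff ?r i = 0" if "i \<ge> n" for i
    using that unfolding coeff_minus coeff_add coeff_jacobi_operator by auto
  ultimately obtain p where p: "\<forall>i. coeff p i \<in> \<real>" "\<forall>i\<ge>n. coeff p i = 0"
    "pearson a b (pderiv p) + smult ?e p = ?r"
    using jacobi_operator_solve[OF assms order_refl, of ?r n] by blast
  show ?thesis
  proof (rule that[of "monom 1 n + p"])
    have "pearson a b (pderiv (monom 1 n + p)) + smult ?e (monom 1 n + p) = 0"
      using p(3) unfolding eq_neg_iff_add_eq_0
      by (simp add: pderiv_add pearson_add smult_add_right add_ac)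
    then show "pearson a b (pderiv (monom 1 n + p)) = smult (- ?e) (monom 1 n + p)"
      by (simp add: eq_neg_iff_add_eq_0)
  qed (use p in auto)
qed

lemma poly_of_real_Reals:
  fixes p :: "complex poly"
  assumes "\<And>i. coeff p i \<in> \<real>"
  shows "poly p (of_real x) \<in> \<real>"
  unfolding poly_altdef by (intro sum_in_Reals Reals_mult Reals_power assms Reals_of_real)


section \<open>The two factors\<close>

text \<open>
  The polynomial matrices of \<open>w\<close> and \<open>W\<close> after the common scalar weight \<open>(1 - x)\<^sup>\<alpha> (1 + x)\<^sup>\<beta>\<close> is split off;
  with the same scalar factor on both sides, adjointness becomes an identity in \<open>\<complex>[x]\<close> modulo
  \<^const>\<open>pearson\<close>.
\<close>

definition diag_weight_poly :: "2 mat_poly" where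
  "diag_weight_poly = vector [vector [[:1, -1:], 0], vector [0, [:1, 0, -1:]]]"

definition darboux_weight_poly :: "real \<Rightarrow> real \<Rightarrow> 2 mat_poly" where
  "darboux_weight_poly \<alpha> k =
     (let c = of_real (\<alpha> + 1 - k) in
      vector [vector [[:of_real (4 * (\<alpha> + 1) - 2 * k), of_real (2 * k):], [:2 * c, - 2 * c:]],
              vector [[:2 * c, - 2 * c:], [:c, - 2 * c, c:]]])"

text \<open>
  The operators \<open>V = \<partial> V\<^sub>1 + V\<^sub>0\<close> and \<open>N = \<partial> N\<^sub>1 + N\<^sub>0\<close> of the introduction, for the action on row vectors.
\<close>

definition left_factor0 :: "real \<Rightarrow> real \<Rightarrow> real \<Rightarrow> complex ^ 2 ^ 2" where
  "left_factor0 \<alpha> \<beta> k = vector [vector [- of_real k, 0],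
     vector [- of_real (\<alpha> + 1 - k), of_real (\<alpha> + \<beta> + 2 - k)]]"

definition left_factor1 :: "2 mat_poly" where
  "left_factor1 = vector [vector [[:1, -1:], [:-2:]], vector [0, [:1, 1:]]]"

definition left_factor :: "real \<Rightarrow> real \<Rightarrow> real \<Rightarrow> 2 diff_op" where
  "left_factor \<alpha> \<beta> k = [:mp_const (left_factor0 \<alpha> \<beta> k), left_factor1:]"

definition right_factor0 :: "real \<Rightarrow> real \<Rightarrow> real \<Rightarrow> complex ^ 2 ^ 2" where
  "right_factor0 \<alpha> \<beta> k = vector [vector [of_real (- 2 * k * (\<alpha> + \<beta> + 2 - k)), 0],
     vector [of_real (- 2 * k * (\<alpha> + 1 - k)), of_real ((\<alpha> + 1 - k) * (k + 1))]]"

definition right_factor1 :: "real \<Rightarrow> real \<Rightarrow> 2 mat_poly" where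
  "right_factor1 \<alpha> k =
     (let c = of_real (\<alpha> + 1 - k); d = of_real (- 2 * k) in
      vector [vector [[:d, d:], [:- 2 * c:]], vector [0, [:- c, c:]]])"

definition right_factor :: "real \<Rightarrow> real \<Rightarrow> real \<Rightarrow> 2 diff_op" where
  "right_factor \<alpha> \<beta> k = [:mp_const (right_factor0 \<alpha> \<beta> k), right_factor1 \<alpha> k:]"

lemma op_act_left_factor:
  "(P \<bullet>\<^sub>D left_factor \<alpha> \<beta> k) $ i $ 1 =
     [:1, -1:] * pderiv (P $ i $ 1) - smult (of_real k) (P $ i $ 1)
     - smult (of_real (\<alpha> + 1 - k)) (P $ i $ 2)"
  "(P \<bullet>\<^sub>D left_factor \<alpha> \<beta> k) $ i $ 2 =
     smult (-2) (pderiv (P $ i $ 1)) + [:1, 1:] * pderiv (P $ i $ 2)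
     + smult (of_real (\<alpha> + \<beta> + 2 - k)) (P $ i $ 2)"
  by (rule poly_eq_poly_eq_iff[THEN iffD1], rule ext,
      simp add: left_factor_def left_factor0_def left_factor1_def op_act_first_order
        matrix_matrix_mult_def sum_2 mp_const_def mp_deriv_def algebra_simps)+

lemma op_act_right_factor:
  "(P \<bullet>\<^sub>D right_factor \<alpha> \<beta> k) $ i $ 1 =
     smult (- 2 * of_real k) ([:1, 1:] * pderiv (P $ i $ 1)
       + smult (of_real (\<alpha> + \<beta> + 2 - k)) (P $ i $ 1) + smult (of_real (\<alpha> + 1 - k)) (P $ i $ 2))"
  "(P \<bullet>\<^sub>D right_factor \<alpha> \<beta> k) $ i $ 2 =
     smult (of_real (\<alpha> + 1 - k)) (smult (-2) (pderiv (P $ i $ 1)) - [:1, -1:] * pderiv (P $ i $ 2)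
       + smult (of_real (k + 1)) (P $ i $ 2))"
  by (rule poly_eq_poly_eq_iff[THEN iffD1], rule ext,
      simp add: right_factor_def right_factor0_def right_factor1_def op_act_first_order
        matrix_matrix_mult_def sum_2 mp_const_def mp_deriv_def Let_def algebra_simps)+

text \<open>
  \<open>N\<close> is the adjoint of \<open>V\<close>.  With \<open>h = 2 f + (1 - x) g\<close> the boundary term comes from integrating by
  parts the products \<open>q' h\<close> and \<open>p' f\<close> in the sum-of-squares form of the weight; this is the
  polynomial \<open>r\<close> of the proof.
\<close>

lemma factors_adjoint:
  assumes "\<alpha> > -1" "\<beta> > -1"
  shows "jacobi_integral \<alpha> \<beta>
      ((P \<bullet>\<^sub>D left_factor \<alpha> \<beta> k ** darboux_weight_poly \<alpha> k ** transpose Q) $ i $ j) =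
    jacobi_integral \<alpha> \<beta>
      ((P ** diag_weight_poly ** transpose (Q \<bullet>\<^sub>D right_factor \<alpha> \<beta> k)) $ i $ j)"
proof -
  define p q f g where "p = P $ i $ 1" "q = P $ i $ 2" "f = Q $ j $ 1" "g = Q $ j $ 2"
  note pqfg = this
  define r where "r = smult (of_real (\<alpha> + 1 - k)) (q * (smult 2 f + [:1, -1:] * g))
    + smult (of_real (2 * k)) (p * f)"
  have "(P \<bullet>\<^sub>D left_factor \<alpha> \<beta> k ** darboux_weight_poly \<alpha> k ** transpose Q) $ i $ j =
    (P ** diag_weight_poly ** transpose (Q \<bullet>\<^sub>D right_factor \<alpha> \<beta> k)) $ i $ j + pearson \<alpha> \<beta> r"
  proof (rule poly_eq_poly_eq_iff[THEN iffD1], rule ext)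
    fix x :: complex
    show "poly ((P \<bullet>\<^sub>D left_factor \<alpha> \<beta> k ** darboux_weight_poly \<alpha> k ** transpose Q) $ i $ j) x =
      poly ((P ** diag_weight_poly ** transpose (Q \<bullet>\<^sub>D right_factor \<alpha> \<beta> k)) $ i $ j
        + pearson \<alpha> \<beta> r) x"
      by (simp add: matrix_matrix_mult_def transpose_def sum_2 darboux_weight_poly_def
          diag_weight_poly_def op_act_left_factor op_act_right_factor pqfg[symmetric] Let_def
          r_def pearson_def pderiv_add pderiv_minus pderiv_smult pderiv_mult pderiv_pCons)
        (simp add: algebra_simps)
  qed
  then show ?thesis
    using assms by (simp add: jacobi_integral_add jacobi_integral_pearson)
qed

text \<open>
  The off-diagonal entries of \<open>V N\<close> cancel, and the diagonal ones are \<open>-2 k (L\<^sub>1 - k c)\<close> and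
  \<open>-(\<alpha> + 1 - k) (L\<^sub>2 - (k + 1) c)\<close> with \<open>c = \<alpha> + \<beta> + 2 - k\<close> and the Jacobi operators \<open>L\<^sub>1, L\<^sub>2\<close> of the two
  entries of \<open>w\<close>.  In particular \<open>V N\<close> is in \<open>\<D>(w)\<close>.
\<close>

lemma factors_eigen:
  assumes p: "pearson (\<alpha> + 1) \<beta> (pderiv p) =
      smult (- of_real (jacobi_eigenvalue (\<alpha> + 1) \<beta> n)) p"
    and q: "pearson (\<alpha> + 1) (\<beta> + 1) (pderiv q) =
      smult (- of_real (jacobi_eigenvalue (\<alpha> + 1) (\<beta> + 1) n)) q"
  defines "P \<equiv> vector [vector [p, 0], vector [0, q]] :: 2 mat_poly"
  shows "P \<bullet>\<^sub>D left_factor \<alpha> \<beta> k \<bullet>\<^sub>D right_factor \<alpha> \<beta> k = mp_const (vector [vector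
      [of_real (2 * k * (jacobi_eigenvalue (\<alpha> + 1) \<beta> n + k * (\<alpha> + \<beta> + 2 - k))), 0],
      vector [0, of_real ((\<alpha> + 1 - k) *
        (jacobi_eigenvalue (\<alpha> + 1) (\<beta> + 1) n + (k + 1) * (\<alpha> + \<beta> + 2 - k)))]]) ** P"
proof -
  let ?X = "P \<bullet>\<^sub>D left_factor \<alpha> \<beta> k \<bullet>\<^sub>D right_factor \<alpha> \<beta> k"
  have "?X $ 1 $ 1 = smult (- 2 * of_real k) (pearson (\<alpha> + 1) \<beta> (pderiv p)
      - smult (of_real (k * (\<alpha> + \<beta> + 2 - k))) p)"
    by (rule poly_eq_poly_eq_iff[THEN iffD1], rule ext)
      (simp add: P_def op_act_left_factor op_act_right_factor pearson_def pderiv_add pderiv_diff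
        pderiv_minus pderiv_smult pderiv_mult pderiv_pCons algebra_simps)
  then have "?X $ 1 $ 1 = smult (of_real (2 * k *
      (jacobi_eigenvalue (\<alpha> + 1) \<beta> n + k * (\<alpha> + \<beta> + 2 - k)))) p"
    unfolding p by (intro poly_eqI) (simp add: algebra_simps)
  moreover have "?X $ 1 $ 2 = 0"
    by (rule poly_eq_poly_eq_iff[THEN iffD1], rule ext)
      (simp add: P_def op_act_left_factor op_act_right_factor pearson_def pderiv_add pderiv_diff
        pderiv_minus pderiv_smult pderiv_mult pderiv_pCons algebra_simps)
  moreover have "?X $ 2 $ 1 = 0"
    by (rule poly_eq_poly_eq_iff[THEN iffD1], rule ext)
      (simp add: P_def op_act_left_factor op_act_right_factor pearson_def pderiv_add pderiv_diff
        pderiv_minus pderiv_smult pderiv_mult pderiv_pCons algebra_simps)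
  moreover have "?X $ 2 $ 2 = smult (- of_real (\<alpha> + 1 - k)) (pearson (\<alpha> + 1) (\<beta> + 1) (pderiv q)
      - smult (of_real ((k + 1) * (\<alpha> + \<beta> + 2 - k))) q)"
    by (rule poly_eq_poly_eq_iff[THEN iffD1], rule ext)
      (simp add: P_def op_act_left_factor op_act_right_factor pearson_def pderiv_add pderiv_diff
        pderiv_minus pderiv_smult pderiv_mult pderiv_pCons algebra_simps)
  then have "?X $ 2 $ 2 = smult (of_real ((\<alpha> + 1 - k) *
      (jacobi_eigenvalue (\<alpha> + 1) (\<beta> + 1) n + (k + 1) * (\<alpha> + \<beta> + 2 - k)))) q"
    unfolding q by (intro poly_eqI) (simp add: algebra_simps)
  ultimately show ?thesis
    unfolding vec_eq_iff forall_2
    by (simp add: P_def matrix_matrix_mult_def mp_const_def sum_2)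
qed

lemma invertible_symbol_left_factor:
  assumes "\<alpha> > -1" "\<beta> > -1" "0 < k" "k < \<alpha> + 1"
  shows "invertible (symbol_at (left_factor0 \<alpha> \<beta> k) left_factor1 m)"
proof -
  have "det (symbol_at (left_factor0 \<alpha> \<beta> k) left_factor1 m) =
      - of_real ((k + real m) * (\<alpha> + \<beta> + 2 - k + real m))"
    by (simp add: det_2 symbol_at_nth left_factor0_def left_factor1_def algebra_simps)
  moreover have "(k + real m) * (\<alpha> + \<beta> + 2 - k + real m) > 0"
    using assms by (intro mult_pos_pos) auto
  then have "(k + real m) * (\<alpha> + \<beta> + 2 - k + real m) \<noteq> 0"
    by linarith
  ultimately show ?thesis
    by (simp only: invertible_det_nz neg_equal_0_iff_equal of_real_eq_0_iff not_False_eq_True)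
qed

lemma degree_preserving_left_factor:
  assumes "\<alpha> > -1" "\<beta> > -1" "0 < k" "k < \<alpha> + 1"
  shows "degree_preserving (left_factor \<alpha> \<beta> k)"
  unfolding left_factor_def
proof (rule degree_preserving_first_order[OF _ invertible_symbol_left_factor[OF assms]])
  have "\<forall>i j. degree (left_factor1 $ i $ j) \<le> 1"
    by (simp add: forall_2 left_factor1_def)
  then show "degree (left_factor1 $ i $ j) \<le> 1" for i j by blast
qed

lemma degree_preserving_right_factor:
  assumes "\<alpha> > -1" "\<beta> > -1" "0 < k" "k < \<alpha> + 1"
  shows "degree_preserving (right_factor \<alpha> \<beta> k)"
  unfolding right_factor_def
proof (rule degree_preserving_first_order)
  have "\<forall>i j. degree (right_factor1 \<alpha> k $ i $ j) \<le> 1"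
    by (simp add: forall_2 right_factor1_def Let_def)
  then show "degree (right_factor1 \<alpha> k $ i $ j) \<le> 1" for i j by blast
  fix m
  let ?T = "symbol_at (right_factor0 \<alpha> \<beta> k) (right_factor1 \<alpha> k) m"
  have "?T $ 1 $ 1 = of_real (- 2 * k * (\<alpha> + \<beta> + 2 - k + real m))" "?T $ 1 $ 2 = 0"
    "?T $ 2 $ 2 = of_real ((\<alpha> + 1 - k) * (k + 1 + real m))"
    by (simp_all add: symbol_at_nth right_factor0_def right_factor1_def Let_def algebra_simps)
  then have "det ?T =
      - of_real (2 * k * (\<alpha> + 1 - k) * ((\<alpha> + \<beta> + 2 - k + real m) * (k + 1 + real m)))"
    by (simp only: det_2) simp
  moreover have "2 * k * (\<alpha> + 1 - k) * ((\<alpha> + \<beta> + 2 - k + real m) * (k + 1 + real m)) > 0"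
    using assms by (intro mult_pos_pos) auto
  then have "2 * k * (\<alpha> + 1 - k) * ((\<alpha> + \<beta> + 2 - k + real m) * (k + 1 + real m)) \<noteq> 0"
    by linarith
  ultimately show "invertible (symbol_at (right_factor0 \<alpha> \<beta> k) (right_factor1 \<alpha> k) m)"
    by (simp only: invertible_det_nz neg_equal_0_iff_equal of_real_eq_0_iff not_False_eq_True)
qed

lemma mult_transpose_swap:
  fixes X Y M :: "'n::finite mat_poly"
  assumes "transpose M = M"
  shows "(X ** M ** transpose Y) $ i $ j = (Y ** M ** transpose X) $ j $ i"
proof -
  have "transpose (X ** M ** transpose Y) = Y ** M ** transpose X"
    by (simp add: matrix_transpose_mul assms matrix_mul_assoc)
  moreover have "(X ** M ** transpose Y) $ i $ j = transpose (X ** M ** transpose Y) $ j $ i"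
    unfolding transpose_def[of "X ** M ** transpose Y"] by simp
  ultimately show ?thesis by simp
qed

text \<open>
  With \<open>S n m = \<langle>P\<^sub>n, P\<^sub>m\<rangle>\<^sub>w\<close> and \<open>T n m = \<langle>P\<^sub>n V, P\<^sub>m V\<rangle>\<^sub>W\<close>, adjointness gives \<open>T n m = S n m \<Lambda>\<^sub>m\<close>.  Both forms are
  symmetric, so on the diagonal the same entry of \<open>T n m\<close> is also \<open>\<Lambda>\<^sub>n\<close> times that of \<open>S n m\<close>, and distinct
  eigenvalues force both to vanish.  Off the diagonal \<open>S\<close> is zero since all matrices involved are
  diagonal.
\<close>

lemma orthogonal_eigenpolynomials:
  fixes P :: "nat \<Rightarrow> 2 mat_poly" and p q :: "nat \<Rightarrow> complex poly"
  assumes par: "\<alpha> > -1" "\<beta> > -1" "0 < k" "k < \<alpha> + 1"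
    and p: "\<And>n. pearson (\<alpha> + 1) \<beta> (pderiv (p n)) =
      smult (- of_real (jacobi_eigenvalue (\<alpha> + 1) \<beta> n)) (p n)"
    and q: "\<And>n. pearson (\<alpha> + 1) (\<beta> + 1) (pderiv (q n)) =
      smult (- of_real (jacobi_eigenvalue (\<alpha> + 1) (\<beta> + 1) n)) (q n)"
    and P: "\<And>n. P n = vector [vector [p n, 0], vector [0, q n]]"
    and "n \<noteq> m"
  shows "jacobi_integral \<alpha> \<beta> ((P n ** diag_weight_poly ** transpose (P m)) $ i $ j) = 0"
    and "jacobi_integral \<alpha> \<beta> ((P n \<bullet>\<^sub>D left_factor \<alpha> \<beta> k ** darboux_weight_poly \<alpha> k
      ** transpose (P m \<bullet>\<^sub>D left_factor \<alpha> \<beta> k)) $ i $ j) = 0"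
proof -
  define l where "l i n = (if i = 1
      then 2 * k * (jacobi_eigenvalue (\<alpha> + 1) \<beta> n + k * (\<alpha> + \<beta> + 2 - k))
      else (\<alpha> + 1 - k) * (jacobi_eigenvalue (\<alpha> + 1) (\<beta> + 1) n + (k + 1) * (\<alpha> + \<beta> + 2 - k)))"
    for i :: 2 and n
  define S where "S n m i j = jacobi_integral \<alpha> \<beta>
    ((P n ** diag_weight_poly ** transpose (P m)) $ i $ j)" for n m i j
  define T where "T n m i j = jacobi_integral \<alpha> \<beta>
    ((P n \<bullet>\<^sub>D left_factor \<alpha> \<beta> k ** darboux_weight_poly \<alpha> k
      ** transpose (P m \<bullet>\<^sub>D left_factor \<alpha> \<beta> k)) $ i $ j)" for n m i j
  have TS: "T n m i j = of_real (l j m) * S n m i j" for n m i j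
  proof -
    have "(P n ** diag_weight_poly ** transpose (P m \<bullet>\<^sub>D left_factor \<alpha> \<beta> k \<bullet>\<^sub>D right_factor \<alpha> \<beta> k)) $ i $ j
      = smult (of_real (l j m)) ((P n ** diag_weight_poly ** transpose (P m)) $ i $ j)"
      unfolding P factors_eigen[OF p q]
      using exhaust_2[of i] exhaust_2[of j]
      by (auto simp: matrix_matrix_mult_def transpose_def sum_2 mp_const_def l_def diag_weight_poly_def)
    then show ?thesis
      by (simp add: T_def S_def factors_adjoint[OF par(1,2)] jacobi_integral_smult)
  qed
  have "S n m i j = 0"
  proof (cases "i = j")
    case True
    have sym: "transpose diag_weight_poly = diag_weight_poly"
      "transpose (darboux_weight_poly \<alpha> k) = darboux_weight_poly \<alpha> k"
      by (simp_all add: transpose_def vec_eq_iff forall_2 diag_weight_poly_def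
          darboux_weight_poly_def Let_def)
    have "T n m i i = T m n i i" "S n m i i = S m n i i"
      unfolding T_def S_def
      by (rule arg_cong[OF mult_transpose_swap[OF sym(2)]])
         (rule arg_cong[OF mult_transpose_swap[OF sym(1)]])
    then have "(of_real (l i m) - of_real (l i n)) * S n m i i = 0"
      using TS[of n m i i] TS[of m n i i] by (simp add: algebra_simps)
    moreover have "l i m \<noteq> l i n"
      using par jacobi_eigenvalue_inj[of "\<alpha> + 1" \<beta> m n] jacobi_eigenvalue_inj[of "\<alpha> + 1" "\<beta> + 1" m n]
        \<open>n \<noteq> m\<close> by (auto simp: l_def)
    ultimately show ?thesis using True by simp
  next
    case False
    then have "(P n ** diag_weight_poly ** transpose (P m)) $ i $ j = 0"
      using exhaust_2[of i] exhaust_2[of j]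
      by (auto simp: P matrix_matrix_mult_def transpose_def sum_2 diag_weight_poly_def)
    then show ?thesis by (simp add: S_def)
  qed
  with TS[of n m i j] show
    "jacobi_integral \<alpha> \<beta> ((P n ** diag_weight_poly ** transpose (P m)) $ i $ j) = 0"
    "jacobi_integral \<alpha> \<beta> ((P n \<bullet>\<^sub>D left_factor \<alpha> \<beta> k ** darboux_weight_poly \<alpha> k
      ** transpose (P m \<bullet>\<^sub>D left_factor \<alpha> \<beta> k)) $ i $ j) = 0"
    by (simp_all add: S_def T_def)
qed


section \<open>The Darboux transformation\<close>

theorem proposition7p1:
  fixes \<alpha> \<beta> k :: real and W w :: "real \<Rightarrow> complex ^ 2 ^ 2"
  assumes "\<alpha> > -1" and "\<beta> > -1" and "0 < k" and "k < \<alpha> + 1"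
    and W: "\<And>x. x \<in> {-1<..<1} \<Longrightarrow> W x = ((1 - x) powr \<alpha> * (1 + x) powr \<beta>) *\<^sub>R
      vector [vector [complex_of_real (4 * (\<alpha> + 1) - 2 * k * (1 - x)),
                      complex_of_real (2 * (\<alpha> + 1 - k) * (1 - x))],
              vector [complex_of_real (2 * (\<alpha> + 1 - k) * (1 - x)),
                      complex_of_real ((\<alpha> + 1 - k) * (1 - x) ^ 2)]]"
    and w: "\<And>x. x \<in> {-1<..<1} \<Longrightarrow> w x =
      vector [vector [complex_of_real ((1 - x) powr (\<alpha> + 1) * (1 + x) powr \<beta>), 0],
              vector [0, complex_of_real ((1 - x) powr (\<alpha> + 1) * (1 + x) powr (\<beta> + 1))]]"
  shows "darboux_transformation {-1<..<1} w W"
proof -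
  note par = assms(1-4)
  let ?J = "jacobi_weight \<alpha> \<beta>" and ?V = "left_factor \<alpha> \<beta> k" and ?N = "right_factor \<alpha> \<beta> k"
  let ?A = "left_factor0 \<alpha> \<beta> k"
  let ?MW = "darboux_weight_poly \<alpha> k"
  have W': "W x = ?J x *\<^sub>R mp_eval ?MW x" if "x \<in> {-1<..<1}" for x
    by (simp add: W[OF that] jacobi_weight_def vec_eq_iff forall_2 mp_eval_def
        darboux_weight_poly_def Let_def power2_eq_square algebra_simps)
  have w': "w x = ?J x *\<^sub>R mp_eval diag_weight_poly x" if "x \<in> {-1<..<1}" for x
    using that by (simp add: w[OF that] jacobi_weight_def vec_eq_iff forall_2 mp_eval_def
        diag_weight_poly_def powr_add)
      (simp add: scaleR_conv_of_real algebra_simps)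
  have "weight_matrix {-1<..<1} W"
  proof (rule weight_matrix_jacobi[OF par(1,2) W'])
    fix x :: real assume x: "x \<in> {-1<..<1}"
    let ?a = "?J x * (4 * (\<alpha> + 1) - 2 * k * (1 - x))"
    let ?b = "?J x * (2 * (\<alpha> + 1 - k) * (1 - x))"
    let ?c = "?J x * ((\<alpha> + 1 - k) * (1 - x) ^ 2)"
    have J: "?J x > 0" using x by (rule jacobi_weight_pos)
    have "W x = vector [vector [complex_of_real ?a, complex_of_real ?b],
        vector [complex_of_real ?b, complex_of_real ?c]]"
      by (simp add: W[OF x] jacobi_weight_def vec_eq_iff forall_2) (simp add: scaleR_conv_of_real)
    moreover have "positive_definite \<dots>"
    proof (rule positive_definite_2)
      have "k * (1 - x) < k * 2" using par x by (intro mult_strict_left_mono) auto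
      then have "4 * (\<alpha> + 1) - 2 * k * (1 - x) > 0" using par by (simp add: algebra_simps)
      with J show "?a > 0" by (rule mult_pos_pos)
      \<comment> \<open>The factor \<open>1 + x\<close> is what remains of \<open>4 (\<alpha> + 1) - 2 k (1 - x) - 4 (\<alpha> + 1 - k)\<close>.\<close>
      have "?a * ?c - ?b\<^sup>2 = 2 * k * (\<alpha> + 1 - k) * (1 + x) * (?J x * (1 - x))\<^sup>2"
        by (simp add: power2_eq_square algebra_simps)
      also have "\<dots> > 0" using J par x by (intro mult_pos_pos) auto
      finally show "?a * ?c - ?b\<^sup>2 > 0" .
    qed
    ultimately show "positive_definite (W x)" by simp
  qed
  moreover have "weight_matrix {-1<..<1} w"
  proof (rule weight_matrix_jacobi[OF par(1,2) w'])
    fix x :: real assume x: "x \<in> {-1<..<1}"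
    then show "positive_definite (w x)"
      using positive_definite_2[of "(1 - x) powr (\<alpha> + 1) * (1 + x) powr \<beta>"
          "(1 - x) powr (\<alpha> + 1) * (1 + x) powr (\<beta> + 1)" 0]
      by (simp add: w)
  qed
  moreover have "\<exists>P P' D V N. monic_orthogonal_polys {-1<..<1} w P \<and>
    monic_orthogonal_polys {-1<..<1} W P' \<and> D \<in> diff_op_algebra {-1<..<1} w \<and> D = V **\<^sub>D N \<and>
    degree_preserving V \<and> degree_preserving N \<and> (\<forall>n. \<exists>A. P n \<bullet>\<^sub>D V = mp_const A ** P' n)"
  proof -
    have "\<exists>p. (\<forall>i. coeff p i \<in> \<real>) \<and> coeff p n = 1 \<and> (\<forall>i>n. coeff p i = 0) \<and>
      pearson (\<alpha> + 1) b (pderiv p) = smult (- of_real (jacobi_eigenvalue (\<alpha> + 1) b n)) p"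
      if "b > -1" for n b
    proof -
      have "(\<alpha> + 1) + b > -2" using that par by linarith
      from monic_jacobi_polynomial_exists[OF this, of n] show ?thesis by metis
    qed
    then have ex: "\<exists>p. \<forall>n. (\<forall>i. coeff (p n) i \<in> \<real>) \<and> coeff (p n) n = 1 \<and>
      (\<forall>i>n. coeff (p n) i = 0) \<and> pearson (\<alpha> + 1) b (pderiv (p n)) =
        smult (- of_real (jacobi_eigenvalue (\<alpha> + 1) b n)) (p n)" if "b > -1" for b
      using that by (intro choice) blast
    obtain p where
      p: "\<And>n i. coeff (p n) i \<in> \<real>" "\<And>n. coeff (p n) n = 1" "\<And>n i. i > n \<Longrightarrow> coeff (p n) i = 0"
      and pe: "\<And>n. pearson (\<alpha> + 1) \<beta> (pderiv (p n)) =
        smult (- of_real (jacobi_eigenvalue (\<alpha> + 1) \<beta> n)) (p n)"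
      using ex[OF par(2)] by blast
    have "\<beta> + 1 > -1" using par by simp
    then obtain q where
      q: "\<And>n i. coeff (q n) i \<in> \<real>" "\<And>n. coeff (q n) n = 1" "\<And>n i. i > n \<Longrightarrow> coeff (q n) i = 0"
      and qe: "\<And>n. pearson (\<alpha> + 1) (\<beta> + 1) (pderiv (q n)) =
        smult (- of_real (jacobi_eigenvalue (\<alpha> + 1) (\<beta> + 1) n)) (q n)"
      using ex[of "\<beta> + 1"] by blast
    define P :: "nat \<Rightarrow> 2 mat_poly" where "P n = vector [vector [p n, 0], vector [0, q n]]" for n
    define X where "X n = P n \<bullet>\<^sub>D ?V" for n
    define T where "T n = symbol_at ?A left_factor1 n" for n
    have "\<exists>B. B ** T n = mat 1 \<and> T n ** B = mat 1" for n
      using invertible_symbol_left_factor[OF par, of n] unfolding invertible_def T_def by blast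
    then obtain B where B: "\<And>n. B n ** T n = mat 1" "\<And>n. T n ** B n = mat 1"
      by metis
    \<comment> \<open>\<open>T n\<close> is the leading coefficient of \<open>X n\<close>, so this is the monic normalization.\<close>
    define P' where "P' n = mp_const (B n) ** X n" for n
    note orth = orthogonal_eigenpolynomials[OF par pe qe P_def]
    have deg1: "degree (left_factor1 $ i $ j) \<le> 1" for i j
      using exhaust_2[of i] exhaust_2[of j] by (auto simp: left_factor1_def)
    have P_monic: "mp_coeff (P n) n = mat 1" and P_deg: "\<And>m. m > n \<Longrightarrow> mp_coeff (P n) m = 0" for n
      by (simp_all add: P_def mp_coeff_def vec_eq_iff forall_2 mat_def p q)
    have X_coeff: "mp_coeff (X n) n = T n" "\<And>m. m > n \<Longrightarrow> mp_coeff (X n) m = 0" for n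
      by (simp_all add: X_def left_factor_def mp_coeff_op_act_first_order[OF deg1] P_deg P_monic T_def)
    have P_real: "poly (P n $ i $ j) (complex_of_real x) \<in> \<real>" for n i j x
      using exhaust_2[of i] exhaust_2[of j] p(1) q(1) by (auto simp: P_def poly_of_real_Reals)
    have dP_real: "poly (pderiv (P n $ i $ j)) (complex_of_real x) \<in> \<real>" for n i j x
      using exhaust_2[of i] exhaust_2[of j] p(1) q(1)
      by (auto simp: P_def coeff_pderiv intro!: poly_of_real_Reals Reals_mult)
    have X_real: "poly (X n $ i $ j) (complex_of_real x) \<in> \<real>" for n i j x
      using exhaust_2[of j] P_real dP_real
      by (auto simp: X_def op_act_left_factor
          intro!: Reals_add Reals_diff Reals_mult)
    have P_orth: "monic_orthogonal_polys {-1<..<1} w P"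
      unfolding monic_orthogonal_polys_def
    proof (intro conjI allI impI)
      show "mp_degree (P n) = n" for n
        by (rule mp_degree_eqI) (simp_all add: P_deg P_monic mat_def vec_eq_iff)
      show "mp_coeff (P n) n = mat 1" for n by (rule P_monic)
      show "(LBINT x:{-1<..<1}. mp_eval (P n) x ** w x ** conj_transpose (mp_eval (P m) x)) = 0"
        if "n \<noteq> m" for n m
        using set_integral_eq_0_if_jacobi_integral_eq_0[OF par(1,2) w' P_real orth(1)[OF that],
            of "mat 1" "mat 1"]
        by (simp only: mp_const_mat_1_mult)
    qed
    have P'_orth: "monic_orthogonal_polys {-1<..<1} W P'"
      unfolding monic_orthogonal_polys_def
    proof (intro conjI allI impI)
      show monic: "mp_coeff (P' n) n = mat 1" for n
        by (simp add: P'_def mp_coeff_mp_const_mult X_coeff B)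
      show "mp_degree (P' n) = n" for n
      proof (rule mp_degree_eqI)
        show "mp_coeff (P' n) n \<noteq> 0" by (simp add: monic) (simp add: mat_def vec_eq_iff)
      qed (simp add: P'_def mp_coeff_mp_const_mult X_coeff)
      show "(LBINT x:{-1<..<1}. mp_eval (P' n) x ** W x ** conj_transpose (mp_eval (P' m) x)) = 0"
        if "n \<noteq> m" for n m
        unfolding P'_def
        by (rule set_integral_eq_0_if_jacobi_integral_eq_0[OF par(1,2) W' X_real])
           (use orth(2)[OF that] in \<open>simp_all add: X_def\<close>)
    qed
    have "\<exists>\<Lambda>. P n \<bullet>\<^sub>D (?V **\<^sub>D ?N) = mp_const \<Lambda> ** P n" for n
      unfolding op_act_op_mult P_def factors_eigen[OF pe qe] by blast
    then have "?V **\<^sub>D ?N \<in> diff_op_algebra {-1<..<1} w"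
      using P_orth unfolding diff_op_algebra_def by blast
    moreover have "P n \<bullet>\<^sub>D ?V = mp_const (T n) ** P' n" for n
      by (simp add: P'_def X_def matrix_mul_assoc B mp_const_mat_1_mult flip: mp_const_mult)
    ultimately show ?thesis
      using P_orth P'_orth degree_preserving_left_factor[OF par] degree_preserving_right_factor[OF par]
      by blast
  qed
  ultimately show ?thesis
    by (simp add: darboux_transformation_def)
qed

end
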